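(* Let $r\ge 3$ be an integer and let $S\subseteq BS(1,r)$ be a finite set of size $k=|S|\ge 1$ with $S=ba^A$, where $A\subseteq\mathbb{Z}$ is a finite set of integers. Then $$|S^2|=|A+r\ast A|\ge\max(4k-4,1)\ge 3k-2.$$
   Context: $BS(1,r)=\langle a,b\mid ab=ba^r\rangle$ is the Baumslag-Solitar group. For finite $A\subseteq\mathbb{Z}$, $ba^A=\{ba^x: x\in A\}$. $S^2=\{s_1s_2: s_1,s_2\in S\}$. $r\ast A=\{rx: x\in A\}$ and $A+r\ast A=\{x+ry: x,y\in A\}$. $|X|$ denotes the size of a finite set $X$. *)

theory Defs
  imports "HOL-Algebra.Coset" "HOL-Library.Set_Algebras"
begin

section \<open>Groups given by generators and relations\<close>

text \<open>A letter \<open>(x, True)\<close> stands for the generator \<open>x\<close>, and \<open>(x, False)\<close> for its formal inverse.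
  A pair \<open>(u, v)\<close> of words in \<open>R\<close> stands for the defining relation \<open>u = v\<close>.\<close>

type_synonym 'g word = "('g \<times> bool) list"

inductive pres_eq :: "('g word \<times> 'g word) set \<Rightarrow> 'g word \<Rightarrow> 'g word \<Rightarrow> bool" for R where
  refl: "pres_eq R u u"
| sym: "pres_eq R u v \<Longrightarrow> pres_eq R v u"
| trans: "pres_eq R u v \<Longrightarrow> pres_eq R v w \<Longrightarrow> pres_eq R u w"
| append: "pres_eq R u u' \<Longrightarrow> pres_eq R v v' \<Longrightarrow> pres_eq R (u @ v) (u' @ v')"
| cancel: "pres_eq R [(x, s), (x, \<not> s)] []"
| rel: "(u, v) \<in> R \<Longrightarrow> pres_eq R u v"

definition word_class :: "('g word \<times> 'g word) set \<Rightarrow> 'g word \<Rightarrow> 'g word set" where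
  "word_class R u = {v. pres_eq R u v}"

text \<open>The product of two classes is described without choosing representatives;
  \<open>mult_word_class\<close> below is the usual formula.\<close>

definition presented_group :: "('g word \<times> 'g word) set \<Rightarrow> 'g word set monoid" where
  "presented_group R =
    \<lparr>carrier = range (word_class R),
     mult = (\<lambda>X Y. {w. \<exists>u\<in>X. \<exists>v\<in>Y. pres_eq R (u @ v) w}),
     one = word_class R []\<rparr>"

lemma word_class_eq_iff: "word_class R u = word_class R v \<longleftrightarrow> pres_eq R u v"
  unfolding word_class_def
  by (auto intro: pres_eq.refl pres_eq.sym pres_eq.trans)

lemma mult_word_class:
  "word_class R u \<otimes>\<^bsub>presented_group R\<^esub> word_class R v = word_class R (u @ v)"
  unfolding presented_group_def word_class_def
  by (auto intro: pres_eq.refl pres_eq.sym pres_eq.trans pres_eq.append)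

lemma one_presented_group: "\<one>\<^bsub>presented_group R\<^esub> = word_class R []"
  by (simp add: presented_group_def)

lemma carrier_presented_group: "carrier (presented_group R) = range (word_class R)"
  by (simp add: presented_group_def)

definition word_inverse :: "'g word \<Rightarrow> 'g word" where
  "word_inverse u = rev (map (\<lambda>(x, s). (x, \<not> s)) u)"

lemma word_inverse_left: "pres_eq R (word_inverse u @ u) []"
proof (induction u)
  case Nil
  show ?case by (simp add: word_inverse_def pres_eq.refl)
next
  case (Cons l u)
  obtain x s where l: "l = (x, s)" by (cases l)
  have "pres_eq R [(x, \<not> s), (x, s)] []"
    using pres_eq.cancel[of R x "\<not> s"] by simp
  then have "pres_eq R ([(x, \<not> s), (x, s)] @ u) ([] @ u)"
    by (intro pres_eq.append pres_eq.refl)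
  then have "pres_eq R (word_inverse u @ [(x, \<not> s), (x, s)] @ u) (word_inverse u @ [] @ u)"
    by (intro pres_eq.append[OF pres_eq.refl])
  then show ?case
    using Cons.IH by (auto simp: word_inverse_def l intro: pres_eq.trans)
qed

theorem group_presented_group: "group (presented_group R)"
proof (rule groupI)
  fix X assume "X \<in> carrier (presented_group R)"
  then obtain u where "X = word_class R u" by (auto simp: carrier_presented_group)
  then have "word_class R (word_inverse u) \<otimes>\<^bsub>presented_group R\<^esub> X = \<one>\<^bsub>presented_group R\<^esub>"
    by (simp add: mult_word_class one_presented_group word_class_eq_iff word_inverse_left)
  then show "\<exists>Y\<in>carrier (presented_group R). Y \<otimes>\<^bsub>presented_group R\<^esub> X = \<one>\<^bsub>presented_group R\<^esub>"
    by (auto simp: carrier_presented_group)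
qed (auto simp: carrier_presented_group mult_word_class one_presented_group)

section \<open>The Baumslag-Solitar group BS(1, r)\<close>

datatype bs_gen = Gen_a | Gen_b

definition gen_power :: "'g \<Rightarrow> int \<Rightarrow> 'g word" where
  "gen_power x n = replicate (nat \<bar>n\<bar>) (x, 0 \<le> n)"

definition bs_relation :: "int \<Rightarrow> (bs_gen word \<times> bs_gen word) set" where
  "bs_relation r =
     {([(Gen_a, True), (Gen_b, True)], (Gen_b, True) # gen_power Gen_a r)}"

definition BS1 :: "int \<Rightarrow> bs_gen word set monoid" where
  "BS1 r = presented_group (bs_relation r)"

definition bs_a :: "int \<Rightarrow> bs_gen word set" where
  "bs_a r = word_class (bs_relation r) [(Gen_a, True)]"

definition bs_b :: "int \<Rightarrow> bs_gen word set" where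
  "bs_b r = word_class (bs_relation r) [(Gen_b, True)]"

definition ba_pow :: "int \<Rightarrow> int set \<Rightarrow> bs_gen word set set" where
  "ba_pow r A = {bs_b r \<otimes>\<^bsub>BS1 r\<^esub> bs_a r [^]\<^bsub>BS1 r\<^esub> x | x. x \<in> A}"

lemma group_BS1: "group (BS1 r)"
  by (simp add: BS1_def group_presented_group)

lemma bs_a_closed [simp]: "bs_a r \<in> carrier (BS1 r)"
  and bs_b_closed [simp]: "bs_b r \<in> carrier (BS1 r)"
  by (simp_all add: bs_a_def bs_b_def BS1_def carrier_presented_group)

lemma bs_a_int_pow: "bs_a r [^]\<^bsub>BS1 r\<^esub> (n::int) = word_class (bs_relation r) (gen_power Gen_a n)"
proof -
  interpret group "BS1 r" by (rule group_BS1)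
  have rep: "word_class (bs_relation r) [(Gen_a, s)] [^]\<^bsub>BS1 r\<^esub> (m::nat)
      = word_class (bs_relation r) (replicate m (Gen_a, s))" for s m
  proof (induction m)
    case 0
    show ?case by (simp add: BS1_def one_presented_group)
  next
    case (Suc m)
    then show ?case
      by (simp add: BS1_def mult_word_class replicate_append_same)
  qed
  show ?thesis
  proof (cases "0 \<le> n")
    case True
    then have "bs_a r [^]\<^bsub>BS1 r\<^esub> n = bs_a r [^]\<^bsub>BS1 r\<^esub> nat n"
      using int_pow_int[of "BS1 r" "bs_a r" "nat n"] by simp
    also have "\<dots> = word_class (bs_relation r) (gen_power Gen_a n)"
      using True by (simp add: bs_a_def rep gen_power_def)
    finally show ?thesis .
  next
    case False
    have "word_class (bs_relation r) [(Gen_a, False)] \<otimes>\<^bsub>BS1 r\<^esub> bs_a r = \<one>\<^bsub>BS1 r\<^esub>"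
      using pres_eq.cancel[of "bs_relation r" Gen_a False]
      by (simp add: bs_a_def BS1_def mult_word_class one_presented_group word_class_eq_iff)
    then have inv: "inv\<^bsub>BS1 r\<^esub> bs_a r = word_class (bs_relation r) [(Gen_a, False)]"
      by (rule inv_equality) (simp, simp add: BS1_def carrier_presented_group)
    have "bs_a r [^]\<^bsub>BS1 r\<^esub> n = inv\<^bsub>BS1 r\<^esub> (bs_a r [^]\<^bsub>BS1 r\<^esub> nat (- n))"
      using False by (subst int_pow_def2) simp
    also have "\<dots> = (inv\<^bsub>BS1 r\<^esub> bs_a r) [^]\<^bsub>BS1 r\<^esub> nat (- n)"
      by (rule nat_pow_inv[symmetric]) simp
    also have "\<dots> = word_class (bs_relation r) (gen_power Gen_a n)"
      using False by (simp add: inv rep gen_power_def)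
    finally show ?thesis .
  qed
qed

lemma bs_a_bs_b: "bs_a r \<otimes>\<^bsub>BS1 r\<^esub> bs_b r = bs_b r \<otimes>\<^bsub>BS1 r\<^esub> bs_a r [^]\<^bsub>BS1 r\<^esub> r"
  unfolding bs_a_int_pow
  by (auto simp: bs_a_def bs_b_def BS1_def mult_word_class word_class_eq_iff bs_relation_def
      intro: pres_eq.rel)

end

theory Submission
  imports Defs Complex_Main "HOL-Number_Theory.Cong"
begin

text \<open>Since \<open>(b a\<^sup>x) (b a\<^sup>y) = b (b a\<^bsup>y + r x\<^esup>)\<close> and \<open>a\<close> has infinite order, everything reduces to
  \<open>|A + r * A| \<ge> 4|A| - 4\<close> for finite sets of integers, proved by strong induction on \<open>|A|\<close>.

  After an affine change of coordinates \<open>A\<close> contains \<open>0\<close> and has gcd \<open>1\<close>, so it meets \<open>j \<ge> 2\<close> residue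
  classes modulo \<open>r\<close>. Applying \<open>|X + Y| \<ge> |X| + |Y| - 1\<close> class by class gives
  \<open>|A + r * A| \<ge> |A| + j (|A| - 1)\<close>, which suffices if \<open>j \<ge> 3\<close>. If \<open>j = 2\<close>, write
  \<open>A = (r * B + u) \<union> (r * C + v)\<close>; then \<open>|A + r * A| = |B + A| + |C + A|\<close>. When \<open>B\<close> misses a residue
  modulo \<open>r\<close>, some translate of \<open>r * C\<close> in \<open>B + A\<close> avoids the residues of \<open>B + r * B + u\<close>, so
  \<open>|B + A| \<ge> |B + r * B| + |C|\<close> and the induction hypothesis applies. When \<open>B\<close> meets all residues,
  \<open>|B + A| \<ge> |B| + r (max |B| |C| - 1)\<close>, and for \<open>|B| = |C|\<close> there is one more element.\<close>

section \<open>The affine action of BS(1, r)\<close>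

text \<open>\<open>a\<close> acts on the rationals as \<open>x \<mapsto> x + 1\<close> and \<open>b\<close> as \<open>x \<mapsto> x / r\<close>; this shows that \<open>a\<close> has infinite order.\<close>

fun letter_act :: "int \<Rightarrow> bs_gen \<times> bool \<Rightarrow> rat \<Rightarrow> rat" where
  "letter_act r (Gen_a, s) x = (if s then x + 1 else x - 1)"
| "letter_act r (Gen_b, s) x = (if s then x / of_int r else x * of_int r)"

definition word_act :: "int \<Rightarrow> bs_gen word \<Rightarrow> rat \<Rightarrow> rat" where
  "word_act r u = foldr (letter_act r) u"

lemma word_act_append [simp]: "word_act r (u @ v) x = word_act r u (word_act r v x)"
  by (simp add: word_act_def)

lemma word_act_Nil [simp]: "word_act r [] x = x"
  by (simp add: word_act_def)

lemma word_act_Cons [simp]: "word_act r (l # u) x = letter_act r l (word_act r u x)"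
  by (simp add: word_act_def)

lemma word_act_gen_power: "word_act r (gen_power Gen_a n) x = x + of_int n"
proof -
  have "word_act r (replicate m (Gen_a, s)) x = (if s then x + of_nat m else x - of_nat m)" for m s
    by (induction m) auto
  then show ?thesis
    by (simp add: gen_power_def)
qed

text \<open>Both sides of the defining relation act as \<open>x\<close> to \<open>x / r + 1\<close>,
  so the action descends to the group.\<close>

lemma word_act_cong:
  assumes "r \<noteq> 0" "pres_eq (bs_relation r) u v"
  shows "word_act r u = word_act r v"
  using assms(2)
proof (induction rule: pres_eq.induct)
  case (cancel x s)
  show ?case
    using \<open>r \<noteq> 0\<close> by (cases x) (auto simp: fun_eq_iff)
next
  case (rel u v)
  then show ?case
    using \<open>r \<noteq> 0\<close>
    by (auto simp: fun_eq_iff bs_relation_def word_act_gen_power field_simps)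
qed (auto simp: fun_eq_iff)

lemma bs_b_bs_a_pow:
  "bs_b r \<otimes>\<^bsub>BS1 r\<^esub> bs_a r [^]\<^bsub>BS1 r\<^esub> (x::int)
    = word_class (bs_relation r) ((Gen_b, True) # gen_power Gen_a x)"
  unfolding bs_a_int_pow by (simp add: bs_b_def BS1_def mult_word_class)

text \<open>The element \<open>b a^x\<close> sends 0 to \<open>x / r\<close>, which determines
  \<open>x\<close>.\<close>

lemma inj_bs_b_bs_a_pow:
  assumes "r \<noteq> 0"
  shows "inj (\<lambda>x::int. bs_b r \<otimes>\<^bsub>BS1 r\<^esub> bs_a r [^]\<^bsub>BS1 r\<^esub> x)"
proof (rule injI)
  fix x y :: int
  assume "bs_b r \<otimes>\<^bsub>BS1 r\<^esub> bs_a r [^]\<^bsub>BS1 r\<^esub> x = bs_b r \<otimes>\<^bsub>BS1 r\<^esub> bs_a r [^]\<^bsub>BS1 r\<^esub> y"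
  then have "word_act r ((Gen_b, True) # gen_power Gen_a x) 0
      = word_act r ((Gen_b, True) # gen_power Gen_a y) 0"
    using word_act_cong[OF assms] by (simp only: bs_b_bs_a_pow word_class_eq_iff)
  then show "x = y"
    using assms by (simp add: word_act_gen_power)
qed

section \<open>Products in BS(1, r) and the passage to sumsets\<close>

lemma bs_a_pow_bs_b:
  "bs_a r [^]\<^bsub>BS1 r\<^esub> (x::int) \<otimes>\<^bsub>BS1 r\<^esub> bs_b r
    = bs_b r \<otimes>\<^bsub>BS1 r\<^esub> bs_a r [^]\<^bsub>BS1 r\<^esub> (r * x)"
proof -
  interpret group "BS1 r" by (rule group_BS1)
  let ?G = "BS1 r" and ?a = "bs_a r" and ?b = "bs_b r"
  \<comment> \<open>Conjugation by \<open>b\<close> is an endomorphism taking \<open>a\<close> to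
    \<open>a^r\<close>; this covers negative exponents \<open>x\<close> as well.\<close>
  define h where "h = (\<lambda>y. inv\<^bsub>?G\<^esub> ?b \<otimes>\<^bsub>?G\<^esub> y \<otimes>\<^bsub>?G\<^esub> ?b)"
  have cancel: "?b \<otimes>\<^bsub>?G\<^esub> (inv\<^bsub>?G\<^esub> ?b \<otimes>\<^bsub>?G\<^esub> z) = z" if "z \<in> carrier ?G" for z
    using that by (simp flip: m_assoc)
  have "h \<in> hom ?G ?G"
    by (rule homI) (simp_all add: h_def m_assoc cancel)
  then interpret h: group_hom ?G ?G h
    by unfold_locales
  have "h ?a = ?a [^]\<^bsub>?G\<^esub> r"
    by (simp add: h_def m_assoc bs_a_bs_b) (simp flip: m_assoc)
  then have "h (?a [^]\<^bsub>?G\<^esub> x) = ?a [^]\<^bsub>?G\<^esub> (r * x)"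
    using h.hom_int_pow[of ?a x] by (simp add: int_pow_pow)
  then have "?b \<otimes>\<^bsub>?G\<^esub> h (?a [^]\<^bsub>?G\<^esub> x) = ?b \<otimes>\<^bsub>?G\<^esub> ?a [^]\<^bsub>?G\<^esub> (r * x)"
    by simp
  then show ?thesis
    by (simp add: h_def m_assoc cancel)
qed

lemma card_ba_pow:
  assumes "r \<noteq> 0"
  shows "card (ba_pow r A) = card A"
proof -
  have "ba_pow r A = (\<lambda>x. bs_b r \<otimes>\<^bsub>BS1 r\<^esub> bs_a r [^]\<^bsub>BS1 r\<^esub> x) ` A"
    by (auto simp: ba_pow_def)
  then show ?thesis
    using inj_bs_b_bs_a_pow[OF assms] by (simp add: card_image inj_on_subset)
qed

text \<open>Splitting off the leading \<open>b\<close> leaves a set of the form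
  \<open>ba_pow\<close>, whose size is known; left multiplication is injective.\<close>

lemma ba_pow_square:
  "ba_pow r A <#>\<^bsub>BS1 r\<^esub> ba_pow r A = (\<lambda>z. bs_b r \<otimes>\<^bsub>BS1 r\<^esub> z) ` ba_pow r (A + r *o A)"
proof -
  interpret group "BS1 r" by (rule group_BS1)
  let ?G = "BS1 r" and ?a = "bs_a r" and ?b = "bs_b r"
  have prod: "(?b \<otimes>\<^bsub>?G\<^esub> ?a [^]\<^bsub>?G\<^esub> x) \<otimes>\<^bsub>?G\<^esub> (?b \<otimes>\<^bsub>?G\<^esub> ?a [^]\<^bsub>?G\<^esub> y)
      = ?b \<otimes>\<^bsub>?G\<^esub> (?b \<otimes>\<^bsub>?G\<^esub> ?a [^]\<^bsub>?G\<^esub> (y + r * x))" for x y :: int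
  proof -
    have "(?b \<otimes>\<^bsub>?G\<^esub> ?a [^]\<^bsub>?G\<^esub> x) \<otimes>\<^bsub>?G\<^esub> (?b \<otimes>\<^bsub>?G\<^esub> ?a [^]\<^bsub>?G\<^esub> y)
        = ?b \<otimes>\<^bsub>?G\<^esub> (?a [^]\<^bsub>?G\<^esub> x \<otimes>\<^bsub>?G\<^esub> ?b) \<otimes>\<^bsub>?G\<^esub> ?a [^]\<^bsub>?G\<^esub> y"
      by (simp add: m_assoc)
    also have "\<dots> = ?b \<otimes>\<^bsub>?G\<^esub> (?b \<otimes>\<^bsub>?G\<^esub> ?a [^]\<^bsub>?G\<^esub> (y + r * x))"
      by (simp add: bs_a_pow_bs_b m_assoc int_pow_mult add.commute[of y])
    finally show ?thesis .
  qed
  let ?w = "\<lambda>x. ?b \<otimes>\<^bsub>?G\<^esub> ?a [^]\<^bsub>?G\<^esub> (x::int)"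
  have pow: "ba_pow r X = ?w ` X" for X
    by (auto simp: ba_pow_def)
  have "ba_pow r A <#>\<^bsub>?G\<^esub> ba_pow r A = (\<Union>x\<in>A. \<Union>y\<in>A. {?w x \<otimes>\<^bsub>?G\<^esub> ?w y})"
    by (simp add: pow set_mult_def)
  also have "\<dots> = (\<Union>x\<in>A. \<Union>y\<in>A. {?b \<otimes>\<^bsub>?G\<^esub> ?w (y + r * x)})"
    by (simp only: prod)
  also have "\<dots> = (\<lambda>z. ?b \<otimes>\<^bsub>?G\<^esub> ?w z) ` (A + r *o A)"
    by (auto simp: set_plus_def elt_set_times_def)
  finally show ?thesis
    by (simp add: pow image_image)
qed

lemma card_ba_pow_square:
  assumes "r \<noteq> 0"
  shows "card (ba_pow r A <#>\<^bsub>BS1 r\<^esub> ba_pow r A) = card (A + r *o A)"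
proof -
  interpret group "BS1 r" by (rule group_BS1)
  have "ba_pow r (A + r *o A) \<subseteq> carrier (BS1 r)"
    by (auto simp: ba_pow_def)
  then have "inj_on (\<lambda>z. bs_b r \<otimes>\<^bsub>BS1 r\<^esub> z) (ba_pow r (A + r *o A))"
    by (rule inj_on_subset[OF inj_on_cmult[OF bs_b_closed]])
  then show ?thesis
    by (simp add: ba_pow_square card_image card_ba_pow[OF assms])
qed

section \<open>Sumsets of integers\<close>

lemma dilate_eq_image: "r *o A = (*) r ` A" for r :: int
  by (auto simp: elt_set_times_def)

lemma finite_dilate [simp]: "finite A \<Longrightarrow> finite (r *o A)" for r :: int
  by (simp add: dilate_eq_image)

text \<open>The summand 0 gives dilates the shape that \<open>affine_image_plus\<close>
  matches.\<close>

lemma dilate_eq_affine_image: "r *o A = (\<lambda>x. r * x + 0) ` A" for r :: int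
  by (simp add: dilate_eq_image)

lemma card_dilate [simp]: "r \<noteq> 0 \<Longrightarrow> card (r *o A) = card A" for r :: int
  by (simp add: dilate_eq_image card_image inj_on_def)

lemma inj_affine: "g \<noteq> 0 \<Longrightarrow> inj_on (\<lambda>x. g * x + a) B" for g :: int
  by (simp add: inj_on_def)

lemma affine_image_plus:
  "(\<lambda>x. g * x + a) ` X + (\<lambda>x. g * x + b) ` Y = (\<lambda>x. g * x + (a + b)) ` (X + Y)" for g :: int
proof -
  have eq: "g * x + a + (g * y + b) = g * (x + y) + (a + b)" for x y
    by (simp add: algebra_simps)
  have "(\<lambda>x. g * x + a) ` X + (\<lambda>x. g * x + b) ` Y
      = (\<Union>x\<in>X. \<Union>y\<in>Y. {g * x + a + (g * y + b)})"
    by (auto simp: set_plus_def)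
  also have "\<dots> = (\<Union>x\<in>X. \<Union>y\<in>Y. {g * (x + y) + (a + b)})"
    by (simp only: eq)
  also have "\<dots> = (\<lambda>x. g * x + (a + b)) ` (X + Y)"
    by (auto simp: set_plus_def)
  finally show ?thesis .
qed

lemma dilate_affine_image:
  "r *o ((\<lambda>x. g * x + a) ` X) = (\<lambda>x. g * x + r * a) ` (r *o X)" for g :: int
  by (simp add: dilate_eq_image image_image algebra_simps)

text \<open>This justifies normalising a set to contain 0 and have gcd 1.\<close>

lemma card_affine_image_plus_dilate:
  fixes g :: int
  assumes "g \<noteq> 0"
  shows "card ((\<lambda>x. g * x + a) ` B + r *o ((\<lambda>x. g * x + a) ` B)) = card (B + r *o B)"
  unfolding dilate_affine_image affine_image_plus by (rule card_image[OF inj_affine[OF assms]])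

lemma card_plus_affine_image:
  "card (B + (\<lambda>x. r * x + u) ` C) = card (B + r *o C)" for r :: int
proof -
  have "B + (\<lambda>x. r * x + u) ` C = (\<lambda>x. 1 * x + (0 + u)) ` (B + r *o C)"
    unfolding affine_image_plus[symmetric] by (simp add: dilate_eq_image image_image)
  then show ?thesis
    by (simp add: card_image)
qed

section \<open>Lower bounds for sumset sizes\<close>

lemma card_sumset_ge:
  fixes X Y :: "int set"
  assumes "finite X" "finite Y" "X \<noteq> {}" "Y \<noteq> {}"
  shows "int (card (X + Y)) \<ge> int (card X) + int (card Y) - 1"
proof -
  \<comment> \<open>Two translates inside \<open>X + Y\<close> that share only \<open>Max X + Min Y\<close>.\<close>
  let ?P = "(\<lambda>x. x + Min Y) ` X" and ?Q = "(\<lambda>y. Max X + y) ` Y"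
  have "?P \<inter> ?Q \<subseteq> {Max X + Min Y}"
  proof
    fix z assume "z \<in> ?P \<inter> ?Q"
    then obtain x y where "x \<in> X" "y \<in> Y" "z = x + Min Y" "z = Max X + y" by auto
    moreover have "x \<le> Max X" "Min Y \<le> y"
      using assms \<open>x \<in> X\<close> \<open>y \<in> Y\<close> by auto
    ultimately show "z \<in> {Max X + Min Y}" by simp
  qed
  then have "card (?P \<inter> ?Q) \<le> 1"
    using card_mono[of "{Max X + Min Y}"] by auto
  moreover have "card ?P + card ?Q = card (?P \<union> ?Q) + card (?P \<inter> ?Q)"
    using assms by (intro card_Un_Int) auto
  moreover have "card ?P = card X" "card ?Q = card Y"
    by (simp_all add: card_image)
  moreover have "card (?P \<union> ?Q) \<le> card (X + Y)"
    using assms by (intro card_mono finite_set_plus) (auto intro!: set_plus_intro Min_in Max_in)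
  ultimately show ?thesis by linarith
qed

text \<open>Adding \<open>r *o Y\<close> preserves residues modulo \<open>r\<close>, so the sumsets
  \<open>F c + r *o Y\<close> are disjoint, and each gains \<open>card Y - 1\<close> over
  \<open>F c\<close>.\<close>

lemma card_plus_dilate_ge:
  fixes X Y :: "int set"
  assumes "finite X" "finite Y" "X \<noteq> {}" "Y \<noteq> {}" "r > 0"
  shows "int (card (X + r *o Y)) \<ge> int (card X) + int (card ((\<lambda>x. x mod r) ` X)) * (int (card Y) - 1)"
proof -
  define R where "R = (\<lambda>x. x mod r) ` X"
  define F where "F c = {x \<in> X. x mod r = c}" for c
  have [simp]: "finite R" "finite (F c)" for c
    using assms by (auto simp: R_def F_def)
  have res: "z mod r = c" if "z \<in> F c + r *o Y" for z c
    using that by (auto simp: F_def set_plus_def elt_set_times_def)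
  have "X = (\<Union>c\<in>R. F c)"
    by (auto simp: R_def F_def)
  then have "card X = card (\<Union>c\<in>R. F c)" by simp
  also have "\<dots> = (\<Sum>c\<in>R. card (F c))"
    by (rule card_UN_disjoint) (simp, simp, auto simp: F_def)
  finally have X: "card X = (\<Sum>c\<in>R. card (F c))" .
  have "X + r *o Y = (\<Union>c\<in>R. F c + r *o Y)"
    by (auto simp: R_def F_def set_plus_def)
  then have "card (X + r *o Y) = card (\<Union>c\<in>R. F c + r *o Y)" by simp
  also have "\<dots> = (\<Sum>c\<in>R. card (F c + r *o Y))"
    using res assms by (intro card_UN_disjoint) (auto intro!: finite_set_plus)
  finally have "int (card (X + r *o Y)) = (\<Sum>c\<in>R. int (card (F c + r *o Y)))" by simp
  also have "\<dots> \<ge> (\<Sum>c\<in>R. int (card (F c)) + (int (card Y) - 1))"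
  proof (rule sum_mono)
    fix c assume "c \<in> R"
    then have "F c \<noteq> {}" by (auto simp: R_def F_def)
    moreover have "r *o Y \<noteq> {}" using assms by (simp add: dilate_eq_image)
    ultimately show "int (card (F c)) + (int (card Y) - 1) \<le> int (card (F c + r *o Y))"
      using card_sumset_ge[of "F c" "r *o Y"] assms by simp
  qed
  finally show ?thesis
    by (simp add: X sum.distrib R_def)
qed

section \<open>Sets meeting exactly two residue classes\<close>

text \<open>Otherwise the residues of \<open>B\<close> would be closed under adding
  \<open>d\<close>, which generates the integers modulo \<open>r\<close>.\<close>

lemma ex_shift_outside:
  fixes B :: "int set"
  assumes "r > 0" "coprime d r" "B \<noteq> {}" "(\<lambda>x. x mod r) ` B \<noteq> {0..<r}"
  shows "\<exists>x\<in>B. \<forall>y\<in>B. (x + d) mod r \<noteq> y mod r"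
proof (rule ccontr)
  assume "\<not> ?thesis"
  then have step: "\<exists>y\<in>B. (x + d) mod r = y mod r" if "x \<in> B" for x
    using that by blast
  obtain x0 where "x0 \<in> B" using assms by blast
  have iter: "\<exists>y\<in>B. (x0 + int n * d) mod r = y mod r" for n
  proof (induction n)
    case 0
    then show ?case using \<open>x0 \<in> B\<close> by auto
  next
    case (Suc n)
    then obtain y where y: "y \<in> B" "(x0 + int n * d) mod r = y mod r" by blast
    obtain z where z: "z \<in> B" "(y + d) mod r = z mod r" using step[OF y(1)] by blast
    have "(x0 + int (Suc n) * d) mod r = ((x0 + int n * d) mod r + d) mod r"
      by (simp add: algebra_simps mod_simps)
    also have "\<dots> = z mod r"
      using y z by (simp add: mod_simps)
    finally show ?case using z by blast
  qed
  have "c \<in> (\<lambda>x. x mod r) ` B" if c: "0 \<le> c" "c < r" for c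
  proof -
    obtain e where e: "[d * e = 1] (mod r)"
      using cong_solve_coprime_int[OF assms(2)] by blast
    \<comment> \<open>With \<open>e\<close> inverse to \<open>d\<close>, this many steps lead from
      \<open>x0\<close> to \<open>c\<close>; reducing modulo \<open>r\<close> makes the count
      nonnegative.\<close>
    define n where "n = nat ((e * (c - x0)) mod r)"
    have "[int n = e * (c - x0)] (mod r)"
      using assms by (simp add: n_def cong_def)
    then have "[x0 + int n * d = x0 + e * (c - x0) * d] (mod r)"
      by (intro cong_add cong_mult cong_refl)
    also have "x0 + e * (c - x0) * d = x0 + (d * e) * (c - x0)"
      by (simp add: algebra_simps)
    also have "[\<dots> = x0 + 1 * (c - x0)] (mod r)"
      by (intro cong_add cong_mult cong_refl e)
    finally have "(x0 + int n * d) mod r = c"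
      using c by (simp add: cong_def)
    then show ?thesis using iter[of n] by auto
  qed
  then have "(\<lambda>x. x mod r) ` B = {0..<r}"
    using assms(1) by auto
  with assms(4) show False by simp
qed

context
  fixes r u v :: int and A B C :: "int set"
  assumes r: "r \<ge> 3" and fin: "finite B" "finite C" and ne: "B \<noteq> {}" "C \<noteq> {}"
    and coprime: "coprime (u - v) r"
    and A: "A = (\<lambda>x. r * x + u) ` B \<union> (\<lambda>x. r * x + v) ` C"
begin

lemma finite_two_classes: "finite A"
  using fin by (simp add: A)

lemma two_classes_neq: "r * x + u \<noteq> r * y + v"
proof
  assume "r * x + u = r * y + v"
  then have "u - v = r * (y - x)" by (simp add: algebra_simps)
  then have "r dvd u - v" by simp
  then have "is_unit r" using coprime by (metis coprime_absorb_right)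
  with r show False by (simp add: zdvd1_eq)
qed

lemma card_two_classes: "card A = card B + card C"
proof -
  have "(\<lambda>x. r * x + u) ` B \<inter> (\<lambda>x. r * x + v) ` C = {}"
    using two_classes_neq by blast
  then show ?thesis
    using fin r by (simp add: A card_Un_disjoint card_image inj_affine)
qed

text \<open>The two blocks of \<open>A\<close> stay in their distinct residue classes after adding
  \<open>r *o A\<close>, and each becomes an affine image of \<open>B + A\<close> or
  \<open>C + A\<close>.\<close>

lemma card_two_classes_plus_dilate: "card (A + r *o A) = card (B + A) + card (C + A)"
proof -
  have Un_plus: "(X \<union> Y) + Z = (X + Z) \<union> (Y + Z)" for X Y Z :: "int set"
    by (auto simp: set_plus_def)
  \<comment> \<open>Deleting \<open>add_0_right\<close> keeps the summand 0 until
    \<open>affine_image_plus\<close> has fired.\<close>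
  have "(\<lambda>x. r * x + w) ` X + r *o A = (\<lambda>x. r * x + w) ` (X + A)" for w X
    by (simp add: dilate_eq_affine_image affine_image_plus del: add_0_right) simp
  then have "A + r *o A = (\<lambda>x. r * x + u) ` (B + A) \<union> (\<lambda>x. r * x + v) ` (C + A)"
    using Un_plus[of "(\<lambda>x. r * x + u) ` B" "(\<lambda>x. r * x + v) ` C" "r *o A"] A by simp
  moreover have "(\<lambda>x. r * x + u) ` (B + A) \<inter> (\<lambda>x. r * x + v) ` (C + A) = {}"
    using two_classes_neq by blast
  ultimately show ?thesis
    using fin r finite_two_classes
    by (simp add: card_Un_disjoint card_image inj_affine finite_set_plus)
qed

lemma not_full_bound:
  assumes "(\<lambda>x. x mod r) ` B \<noteq> {0..<r}"
  shows "int (card (B + A)) \<ge> int (card (B + r *o B)) + int (card C)"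
proof -
  have "coprime (v - u) r"
    using coprime by (metis coprime_minus_left_iff minus_diff_eq)
  then obtain x where x: "x \<in> B" "\<And>y. y \<in> B \<Longrightarrow> (x + (v - u)) mod r \<noteq> y mod r"
    using ex_shift_outside[of r "v - u" B] assms r ne by auto
  \<comment> \<open>Modulo \<open>r\<close>, \<open>?P\<close> takes the values \<open>y + u\<close>
    with \<open>y\<close> in \<open>B\<close>, and \<open>?Q\<close> only \<open>x + v\<close>; the
    choice of \<open>x\<close> separates them.\<close>
  let ?P = "B + (\<lambda>x. r * x + u) ` B" and ?Q = "{x} + (\<lambda>x. r * x + v) ` C"
  have "?P \<inter> ?Q = {}"
  proof -
    have "y + (r * b + u) \<noteq> x + (r * c + v)" if "y \<in> B" for y b c
    proof
      assume "y + (r * b + u) = x + (r * c + v)"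
      then have "x + (v - u) - y = r * (b - c)" by (simp add: algebra_simps)
      then have "(x + (v - u)) mod r = y mod r" by (simp add: mod_eq_dvd_iff)
      with x(2)[OF that] show False by simp
    qed
    then show ?thesis by (auto elim!: set_plus_elim)
  qed
  moreover have "?P \<union> ?Q \<subseteq> B + A"
    using x by (auto simp: A set_plus_def)
  moreover have "card ?Q = card C"
  proof -
    have "?Q = (\<lambda>c. r * c + (x + v)) ` C"
      by (auto simp: set_plus_def)
    then show ?thesis
      using r by (simp add: card_image inj_affine)
  qed
  ultimately show ?thesis
    using card_mono[of "B + A" "?P \<union> ?Q"] fin finite_two_classes
    by (simp add: card_Un_disjoint finite_set_plus card_plus_affine_image)
qed

text \<open>\<open>B\<close> meets all \<open>r\<close> classes, so
  \<open>card_plus_dilate_ge\<close> gives the factor \<open>r\<close> with either block of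
  \<open>A\<close> as second summand.\<close>

lemma full_bounds:
  assumes "(\<lambda>x. x mod r) ` B = {0..<r}"
  shows "int (card (B + A)) \<ge> int (card B) + r * (int (card B) - 1)"
    and "int (card (B + A)) \<ge> int (card B) + r * (int (card C) - 1)"
    and "card B = card C \<Longrightarrow> int (card (B + A)) \<ge> int (card B) + r * (int (card B) - 1) + 1"
proof -
  let ?U = "(\<lambda>x. r * x + u) ` B" and ?V = "(\<lambda>x. r * x + v) ` C"
  have full: "int (card ((\<lambda>x. x mod r) ` B)) = r"
    using assms r by simp
  have U: "int (card (B + ?U)) \<ge> int (card B) + r * (int (card B) - 1)"
    using card_plus_dilate_ge[of B B r] fin ne r full by (simp add: card_plus_affine_image)
  have V: "int (card (B + ?V)) \<ge> int (card B) + r * (int (card C) - 1)"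
    using card_plus_dilate_ge[of B C r] fin ne r full by (simp add: card_plus_affine_image)
  have finBA: "finite (B + A)"
    using fin finite_two_classes by (simp add: finite_set_plus)
  have UA: "B + ?U \<subseteq> B + A" and VA: "B + ?V \<subseteq> B + A"
    by (auto simp: A set_plus_def)
  show "int (card (B + A)) \<ge> int (card B) + r * (int (card B) - 1)"
    using U card_mono[OF finBA UA] by linarith
  show "int (card (B + A)) \<ge> int (card B) + r * (int (card C) - 1)"
    using V card_mono[OF finBA VA] by linarith
  \<comment> \<open>\<open>B + ?U\<close> and \<open>B + ?V\<close> cannot both exhaust \<open>B + A\<close>: comparing minima would force
    \<open>Min ?U = Min ?V\<close>, but \<open>?U\<close> and \<open>?V\<close> are disjoint.\<close>
  assume eq: "card B = card C"
  show "int (card (B + A)) \<ge> int (card B) + r * (int (card B) - 1) + 1"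
  proof (rule ccontr)
    assume "\<not> ?thesis"
    then have "card (B + A) \<le> card (B + ?U)" "card (B + A) \<le> card (B + ?V)"
      using U V eq by simp_all
    then have "B + ?U = B + A" "B + ?V = B + A"
      using card_seteq[OF finBA UA] card_seteq[OF finBA VA] by auto
    then have "B + ?U = B + ?V" by simp
    moreover have "Min (B + X) = Min B + Min X" if "finite X" "X \<noteq> {}" for X
      using that fin ne by (intro Min_eqI finite_set_plus) (auto elim!: set_plus_elim intro!: add_mono set_plus_intro Min_in)
    ultimately have "Min ?U = Min ?V"
      using fin ne by (metis add_left_imp_eq finite_imageI image_is_empty)
    moreover have "Min ?U \<in> ?U" "Min ?V \<in> ?V"
      using fin ne by (simp_all only: Min_in finite_imageI image_is_empty not_False_eq_True)
    ultimately have "?U \<inter> ?V \<noteq> {}" by (metis disjoint_iff)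
    then show False using two_classes_neq by blast
  qed
qed

lemma full_card_ge:
  assumes "(\<lambda>x. x mod r) ` B = {0..<r}"
  shows "int (card B) \<ge> r"
  using card_image_le[OF fin(1), of "\<lambda>x. x mod r"] assms r by simp

end

lemma two_classes_bound:
  fixes r u v :: int and A B C :: "int set"
  assumes r: "r \<ge> 3" and fin: "finite B" "finite C" and ne: "B \<noteq> {}" "C \<noteq> {}"
    and cop: "coprime (u - v) r"
    and A: "A = (\<lambda>x. r * x + u) ` B \<union> (\<lambda>x. r * x + v) ` C"
    and IHB: "int (card (B + r *o B)) \<ge> max (4 * int (card B) - 4) 1"
    and IHC: "int (card (C + r *o C)) \<ge> max (4 * int (card C) - 4) 1"
  shows "int (card (A + r *o A)) \<ge> 4 * int (card A) - 4"
proof -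
  have cop': "coprime (v - u) r"
    using cop by (metis coprime_minus_left_iff minus_diff_eq)
  have A': "A = (\<lambda>x. r * x + v) ` C \<union> (\<lambda>x. r * x + u) ` B"
    using A by blast
  note h = r fin ne cop A and h' = r fin(2,1) ne(2,1) cop' A'
  have card: "int (card A) = int (card B) + int (card C)"
    "int (card (A + r *o A)) = int (card (B + A)) + int (card (C + A))"
    using card_two_classes[OF h] card_two_classes_plus_dilate[OF h] by simp_all
  have pos: "int (card B) \<ge> 1" "int (card C) \<ge> 1"
    using fin ne by (simp_all add: Suc_le_eq card_gt_0_iff)
  have mono: "r * (int n - 1) \<ge> 3 * (int n - 1)" if "int n \<ge> 1" for n
    using that r by (intro mult_right_mono) auto
  have ihB: "int (card (B + r *o B)) \<ge> 4 * int (card B) - 4" "int (card (B + r *o B)) \<ge> 1"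
    and ihC: "int (card (C + r *o C)) \<ge> 4 * int (card C) - 4" "int (card (C + r *o C)) \<ge> 1"
    using IHB IHC by simp_all
  note mB = mono[OF pos(1)] and mC = mono[OF pos(2)]
  let ?fB = "(\<lambda>x. x mod r) ` B = {0..<r}" and ?fC = "(\<lambda>x. x mod r) ` C = {0..<r}"
  consider "?fB" "?fC" | "?fB" "\<not> ?fC" | "\<not> ?fB" "?fC" | "\<not> ?fB" "\<not> ?fC" by blast
  then show ?thesis
  proof cases
    case 1
    note b = full_bounds[OF h 1(1)] and c = full_bounds[OF h' 1(2)]
    consider "card B = card C" | "card B < card C" | "card C < card B" by linarith
    then show ?thesis
    proof cases
      \<comment> \<open>The weaker bounds would total only \<open>4 * card A - 6\<close>; the extra
        element on each side closes the gap.\<close>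
      case 1
      then show ?thesis using b(3) c(3) card mB mC by simp
    next
      case 2
      then show ?thesis using b(2) c(1) card mB mC by simp
    next
      case 3
      then show ?thesis using b(1) c(2) card mB mC by simp
    qed
  next
    \<comment> \<open>If \<open>card C\<close> is at most \<open>card B\<close>, the
      \<open>4 * card\<close> bounds fall short by 3 before the summand \<open>card B\<close> is
      counted, and \<open>card B\<close> is at least \<open>r\<close>. Otherwise the bound using
      \<open>card C\<close> suffices.\<close>
    case 2
    have "int (card (B + A)) \<ge> 4 * int (card B) - 3"
      "int (card (B + A)) \<ge> int (card B) + 3 * int (card C) - 3"
      using full_bounds(1,2)[OF h 2(1)] mB mC by simp_all
    then show ?thesis
      using full_card_ge[OF h 2(1)] not_full_bound[OF h' 2(2)] card ihC r pos
      by (cases "int (card B) < int (card C)") linarith+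
  next
    case 3
    have "int (card (C + A)) \<ge> 4 * int (card C) - 3"
      "int (card (C + A)) \<ge> int (card C) + 3 * int (card B) - 3"
      using full_bounds(1,2)[OF h' 3(2)] mB mC by simp_all
    then show ?thesis
      using full_card_ge[OF h' 3(2)] not_full_bound[OF h 3(1)] card ihB r pos
      by (cases "int (card C) < int (card B)") linarith+
  next
    \<comment> \<open>For singletons the bound 1 from the \<open>max\<close> replaces
      \<open>4 * 1 - 4 = 0\<close>; sizes 1 and 1, or 1 and 2, depend on it.\<close>
    case 4
    then show ?thesis
      using not_full_bound[OF h 4(1)] not_full_bound[OF h' 4(2)] card ihB ihC pos
      by (cases "int (card B) = 1"; cases "int (card C) = 1") linarith+
  qed
qed

section \<open>The bound for \<open>A + r \<cdot> A\<close>\<close>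

text \<open>Translate an element to 0 and divide by the gcd of the differences, nonzero because two
  elements differ.\<close>

lemma affine_normal_form:
  fixes A :: "int set"
  assumes "card A \<ge> 2"
  obtains g a B where "g \<noteq> 0" "A = (\<lambda>x. g * x + a) ` B" "0 \<in> B" "Gcd B = 1"
proof -
  obtain a where a: "a \<in> A" using assms by fastforce
  define D where "D = (\<lambda>x. x - a) ` A"
  define g where "g = Gcd D"
  have "\<not> D \<subseteq> {0}"
  proof
    assume "D \<subseteq> {0}"
    then have "A \<subseteq> {a}" by (auto simp: D_def)
    then have "card A \<le> 1" using card_mono[of "{a}" A] by simp
    with assms show False by simp
  qed
  then have g: "g \<noteq> 0" by (simp add: g_def Gcd_0_iff)
  define B where "B = (\<lambda>x. x div g) ` D"
  have D: "D = (\<lambda>x. g * x) ` B"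
  proof -
    have "g * (x div g) = x" if "x \<in> D" for x
      using Gcd_dvd[OF that] by (simp add: g_def)
    then show ?thesis by (simp add: B_def image_image)
  qed
  have "A = (\<lambda>x. g * x + a) ` B"
  proof -
    have "A = (\<lambda>x. x + a) ` D" by (simp add: D_def image_image)
    then show ?thesis by (simp add: D image_image)
  qed
  moreover have "0 \<in> B" using a by (force simp: B_def D_def)
  moreover have "Gcd B = 1"
  proof -
    have "g = Gcd ((*) g ` B)" using D by (simp add: g_def)
    also have "\<dots> = \<bar>g * Gcd B\<bar>" by (simp add: Gcd_mult abs_mult)
    finally have "g = \<bar>g\<bar> * Gcd B" by (simp add: abs_mult)
    moreover have "g \<ge> 0" by (simp add: g_def)
    ultimately show ?thesis using g by simp
  qed
  ultimately show ?thesis using that g by blast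
qed

theorem card_plus_dilate_lower_bound:
  fixes A :: "int set"
  assumes "r \<ge> 3" "finite A" "A \<noteq> {}"
  shows "int (card (A + r *o A)) \<ge> max (4 * int (card A) - 4) 1"
  using assms(2,3)
proof (induction "card A" arbitrary: A rule: less_induct)
  case (less A)
  have pos: "int (card (A + r *o A)) \<ge> 1"
  proof -
    have "A + r *o A \<noteq> {}" "finite (A + r *o A)"
      using less.prems by (auto simp: set_plus_def elt_set_times_def finite_set_plus)
    then show ?thesis by (simp add: Suc_le_eq card_gt_0_iff)
  qed
  show ?case
  proof (cases "card A \<ge> 2")
    case False
    then show ?thesis using pos by simp
  next
    case True
    then obtain g a D where D: "g \<noteq> 0" "A = (\<lambda>x. g * x + a) ` D" "0 \<in> D" "Gcd D = 1"
      by (rule affine_normal_form)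
    have finD: "finite D" using less.prems D inj_affine finite_imageD by blast
    have cardD: "card D = card A" using D by (simp add: card_image inj_affine)
    define R where "R = (\<lambda>x. x mod r) ` D"
    have R: "finite R" "0 \<in> R" using finD D by (force simp: R_def)+
    \<comment> \<open>Gcd 1 forbids all elements of \<open>D\<close> from being divisible by
      \<open>r\<close>, so at least two classes occur.\<close>
    have not0: "R \<noteq> {0}"
    proof
      assume "R = {0}"
      then have "r dvd x" if "x \<in> D" for x using that by (auto simp: R_def)
      then have "r dvd Gcd D" by (rule Gcd_greatest)
      with D assms show False by simp
    qed
    have "int (card (D + r *o D)) \<ge> 4 * int (card D) - 4"
    proof (cases "card R \<ge> 3")
      case True
      have "int (card R) * (int (card D) - 1) \<ge> 3 * (int (card D) - 1)"
        using True cardD \<open>card A \<ge> 2\<close> by (intro mult_right_mono) auto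
      moreover have "D \<noteq> {}" using D by blast
      ultimately show ?thesis
        using card_plus_dilate_ge[of D D r] finD assms by (simp add: R_def)
    next
      case False
      obtain v where v: "v \<in> R" "v \<noteq> 0" using R not0 by blast
      have "R = {0, v}"
        using False R v card_seteq[of R "{0, v}"] by auto
      define B C where "B = {x. r * x + 0 \<in> D}" and "C = {x. r * x + v \<in> D}"
      have DU: "D = (\<lambda>x. r * x + 0) ` B \<union> (\<lambda>x. r * x + v) ` C"
      proof -
        have "x \<in> (\<lambda>x. r * x + 0) ` B \<union> (\<lambda>x. r * x + v) ` C" if "x \<in> D" for x
        proof -
          have "x mod r = 0 \<or> x mod r = v" using that \<open>R = {0, v}\<close> by (auto simp: R_def)
          moreover have "x = r * (x div r) + x mod r" by simp
          ultimately show ?thesis using that unfolding B_def C_def by (metis (mono_tags, lifting) UnCI image_eqI mem_Collect_eq)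
        qed
        then show ?thesis by (auto simp: B_def C_def)
      qed
      have fin: "finite B" "finite C"
        using finD DU assms(1) inj_affine[of r]
        by (metis finite_Un finite_imageD not_numeral_le_zero)+
      have ne: "B \<noteq> {}" "C \<noteq> {}"
      proof -
        have "0 \<in> B" using D by (simp add: B_def)
        then show "B \<noteq> {}" by blast
        obtain x where "x \<in> D" "x mod r = v" using v by (auto simp: R_def)
        then have "x div r \<in> C" by (auto simp: C_def)
        then show "C \<noteq> {}" by blast
      qed
      \<comment> \<open>Every element of \<open>D\<close> is \<open>r * x\<close> or
        \<open>r * x + v\<close>, so \<open>gcd v r\<close> divides
        \<open>Gcd D = 1\<close>.\<close>
      have cop: "coprime (0 - v) r"
      proof -
        have "gcd v r dvd x" if "x \<in> D" for x
          using that DU by (auto intro!: dvd_add intro: dvd_mult2)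
        then have "gcd v r dvd Gcd D" by (rule Gcd_greatest)
        then show ?thesis using D by (simp add: coprime_iff_gcd_eq_1)
      qed
      have "card D = card B + card C"
        by (rule card_two_classes[OF assms(1) fin ne cop DU])
      then have "card B < card A" "card C < card A"
        using cardD fin ne by (auto simp: card_gt_0_iff)
      then show ?thesis
        using two_classes_bound[OF assms(1) fin ne cop DU] less.hyps fin ne by blast
    qed
    then show ?thesis
      using pos card_affine_image_plus_dilate[OF D(1), of a D r] cardD D(2) by simp
  qed
qed

theorem corollary1:
  fixes r :: int and A :: "int set" and S :: "bs_gen word set set" and k :: nat
  assumes "r \<ge> 3"
    and "S \<subseteq> carrier (BS1 r)" and "finite S" and "k = card S" and "k \<ge> 1"
    and "finite A" and "S = ba_pow r A"
  shows "card (S <#>\<^bsub>BS1 r\<^esub> S) = card (A + r *o A)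
    \<and> int (card (A + r *o A)) \<ge> max (4 * int k - 4) 1
    \<and> max (4 * int k - 4) 1 \<ge> 3 * int k - 2"
proof -
  have "r \<noteq> 0" using assms(1) by simp
  then have "k = card A" using assms card_ba_pow by simp
  then have "A \<noteq> {}" using assms(5) by auto
  then show ?thesis
    using card_ba_pow_square[OF \<open>r \<noteq> 0\<close>] card_plus_dilate_lower_bound[OF assms(1,6)]
      assms(5,7) \<open>k = card A\<close> by auto
qed

end
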